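(* Fix $x$ and $b\in(0,1]$. For every $\varepsilon\in(0,1)$ and $\xi>0$ there exists an instance $(\mathcal Y,\pi_{\mathrm{ref}},r^\star,g^\star,\widehat r,\widehat g)$ with exactly two outputs ($|\mathcal Y|=2$) such that $$\mathbb P_{y\sim\pi_{\mathrm{ref}}(\cdot\mid x)}[y\in B(x,b)]=\varepsilon,$$ $$\sqrt{\mathbb E_{y\sim\pi_{\mathrm{ref}}(\cdot\mid x)}\bigl[(\widehat g(x,y)-g^\star(x,y))^2\bigr]}=b\sqrt{\varepsilon},\qquad \sqrt{\mathbb E_{y\sim\pi_{\mathrm{ref}}(\cdot\mid x)}\bigl[(\widehat r(x,y)-r^\star(x,y))^2\bigr]}=\xi\sqrt{\varepsilon},$$ and, for every integer $N\ge1$, the output $\widehat y_N^{\mathrm{BoN}}(x)$ of constrained Best-of-$N$ on $N$ i.i.d. candidates from $\pi_{\mathrm{ref}}(\cdot\mid x)$ satisfies $$\mathbb P\left[\widehat y_N^{\mathrm{BoN}}(x)\in B(x,b)\right]=1-(1-\varepsilon)^N\ge 1-e^{-N\varepsilon}.$$ Consequently, for every $\delta\in(0,1)$, any $N\ge\varepsilon^{-1}\log(1/\delta)$ yields $\mathbb P[\widehat y_N^{\mathrm{BoN}}(x)\in B(x,b)]\ge 1-\delta$ in this instance.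
   Context: An instance consists of an output set $\mathcal Y$, a reference distribution $\pi_{\mathrm{ref}}(\cdot\mid x)$ on $\mathcal Y$, a true reward $r^\star(x,\cdot):\mathcal Y\to\mathbb R_+$ (nonnegative reals), a true binary safety function $g^\star(x,\cdot):\mathcal Y\to\{0,1\}$ (value $1$ means truly safe), a learned reward proxy $\widehat r(x,\cdot):\mathcal Y\to\mathbb R$, and a learned safety proxy $\widehat g(x,\cdot):\mathcal Y\to[0,1]$. For $b\in(0,1]$ the proxy-feasible set is $\widehat{\mathcal S}_+(x,b)=\{y\in\mathcal Y:\widehat g(x,y)\ge b\}$, and $B(x,b)=\{y\in\widehat{\mathcal S}_+(x,b): g^\star(x,y)=0\}$ is the set of unsafe-but-feasible outputs. Constrained Best-of-$N$: given candidates $y_1,\ldots,y_N$, let $\mathcal I_N(x,b)=\{i\in\{1,\dots,N\}: y_i\in\widehat{\mathcal S}_+(x,b)\}$. If $\mathcal I_N(x,b)\ne\varnothing$, it returns $\widehat y_N^{\mathrm{BoN}}(x)=y_{i^*}$ for some $i^*\in\arg\max_{i\in\mathcal I_N(x,b)}\widehat r(x,y_i)$, ties being broken arbitrarily. If $\mathcal I_N(x,b)=\varnothing$ it abstains, and abstention does not count as the event $\widehat y_N^{\mathrm{BoN}}(x)\in B(x,b)$. *)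

theory Defs
  imports "HOL-Probability.Probability"
begin

record ('x, 'y) bon_instance =
  outputs :: "'y set"
  pi_ref :: "'x \<Rightarrow> 'y pmf"
  r_star :: "'x \<Rightarrow> 'y \<Rightarrow> real"
  g_star :: "'x \<Rightarrow> 'y \<Rightarrow> real"
  r_hat :: "'x \<Rightarrow> 'y \<Rightarrow> real"
  g_hat :: "'x \<Rightarrow> 'y \<Rightarrow> real"

definition wf_instance :: "('x, 'y) bon_instance \<Rightarrow> bool" where
  "wf_instance I \<longleftrightarrow>
     (\<forall>x. set_pmf (pi_ref I x) \<subseteq> outputs I) \<and>
     (\<forall>x. \<forall>y\<in>outputs I. r_star I x y \<ge> 0 \<and> g_star I x y \<in> {0, 1} \<and> g_hat I x y \<in> {0..1})"

definition feasible_set :: "('x, 'y) bon_instance \<Rightarrow> 'x \<Rightarrow> real \<Rightarrow> 'y set" where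
  "feasible_set I x b = {y \<in> outputs I. g_hat I x y \<ge> b}"

definition bad_set :: "('x, 'y) bon_instance \<Rightarrow> 'x \<Rightarrow> real \<Rightarrow> 'y set" where
  "bad_set I x b = {y \<in> feasible_set I x b. g_star I x y = 0}"

definition rmse :: "'y pmf \<Rightarrow> ('y \<Rightarrow> real) \<Rightarrow> ('y \<Rightarrow> real) \<Rightarrow> real" where
  "rmse p f g = sqrt (measure_pmf.expectation p (\<lambda>y. (f y - g y)\<^sup>2))"

definition feasible_idx ::
  "('x, 'y) bon_instance \<Rightarrow> 'x \<Rightarrow> real \<Rightarrow> nat \<Rightarrow> (nat \<Rightarrow> 'y) \<Rightarrow> nat set" where
  "feasible_idx I x b N ys = {i \<in> {1..N}. ys i \<in> feasible_set I x b}"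

text \<open>
  Arbitrary tie-breaking: a selection rule maps the candidates \<open>y\<^sub>1, \<dots>, y\<^sub>N\<close> to a distribution
  over the chosen index (\<^const>\<open>None\<close> is abstention), constrained only to put all its mass on maximisers
  of the proxy reward. Every deterministic and every randomised way of breaking ties is thus covered.
\<close>

definition bon_selection ::
  "('x, 'y) bon_instance \<Rightarrow> 'x \<Rightarrow> real \<Rightarrow> nat \<Rightarrow> ((nat \<Rightarrow> 'y) \<Rightarrow> nat option pmf) \<Rightarrow> bool" where
  "bon_selection I x b N sel \<longleftrightarrow>
     (\<forall>ys. (\<forall>i\<in>{1..N}. ys i \<in> outputs I) \<longrightarrow>
       (if feasible_idx I x b N ys = {} then sel ys = return_pmf None
        else set_pmf (sel ys) \<subseteq>
          Some ` {i. is_arg_max (\<lambda>i. r_hat I x (ys i)) (\<lambda>i. i \<in> feasible_idx I x b N ys) i}))"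

text \<open>
  Law of the output on \<open>N\<close> i.i.d. candidates. The second argument of \<^const>\<open>Pi_pmf\<close> is only the value
  of the candidate function outside \<open>{1..N}\<close>.
\<close>

definition bon_output ::
  "('x, 'y) bon_instance \<Rightarrow> 'x \<Rightarrow> nat \<Rightarrow> ((nat \<Rightarrow> 'y) \<Rightarrow> nat option pmf) \<Rightarrow> 'y option pmf" where
  "bon_output I x N sel =
     bind_pmf (Pi_pmf {1..N} undefined (\<lambda>_. pi_ref I x))
       (\<lambda>ys. map_pmf (map_option ys) (sel ys))"

lemma bon_selection_exists: "\<exists>sel. bon_selection I x b N sel"
proof -
  have "\<exists>i. is_arg_max (\<lambda>i. r_hat I x (ys i)) (\<lambda>i. i \<in> feasible_idx I x b N ys) i"
    if "feasible_idx I x b N ys \<noteq> {}" for ys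
  proof -
    let ?A = "feasible_idx I x b N ys" and ?f = "\<lambda>i. r_hat I x (ys i)"
    have fin: "finite ?A" by (simp add: feasible_idx_def)
    have "Max (?f ` ?A) \<in> ?f ` ?A" using fin that by (intro Max_in) auto
    then obtain i where i: "i \<in> ?A" "?f i = Max (?f ` ?A)" by auto
    have "is_arg_max ?f (\<lambda>i. i \<in> ?A) i"
      unfolding is_arg_max_linorder using i fin by auto
    then show ?thesis ..
  qed
  then have "\<forall>ys. \<exists>p. if feasible_idx I x b N ys = {} then p = return_pmf None
        else set_pmf p \<subseteq>
          Some ` {i. is_arg_max (\<lambda>i. r_hat I x (ys i)) (\<lambda>i. i \<in> feasible_idx I x b N ys) i}"
    by (metis (mono_tags, lifting) empty_subsetI imageI insert_subset mem_Collect_eq set_return_pmf)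
  then show ?thesis
    unfolding bon_selection_def by metis
qed

end

theory Submission imports Defs begin

text \<open>
  If every bad output has a larger proxy reward than every other feasible output, Best-of-\<open>N\<close> returns
  a bad output exactly when at least one candidate is bad, whatever the tie-breaking. The witness is
  a Bernoulli reference distribution whose atom of mass \<open>\<epsilon>\<close> is unsafe, has proxy safety exactly \<open>b\<close>
  and proxy reward \<open>\<xi>\<close>; the proxies are exact on the other atom.
\<close>

lemma map_pmf_eq_return_pmf:
  assumes "\<And>z. z \<in> set_pmf p \<Longrightarrow> f z = c"
  shows "map_pmf f p = return_pmf c"
  using assms by (simp cong: map_pmf_cong)

text \<open>A selected feasible candidate that is not bad would be strictly beaten by any bad
  candidate, contradicting maximality; conversely, the selected output is itself one of the
  candidates. The claim is made for each \<open>z\<close> in the support of \<open>sel ys\<close>,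
  so randomised tie-breaking is covered too.\<close>

lemma bon_selection_bad_iff:
  assumes sel: "bon_selection I x b N sel"
    and ys: "\<And>i. i \<in> {1..N} \<Longrightarrow> ys i \<in> outputs I"
    and dom: "\<And>y z. y \<in> feasible_set I x b - bad_set I x b \<Longrightarrow> z \<in> bad_set I x b \<Longrightarrow>
                r_hat I x y < r_hat I x z"
    and z: "z \<in> set_pmf (sel ys)"
  shows "map_option ys z \<in> Some ` bad_set I x b \<longleftrightarrow> (\<exists>i\<in>{1..N}. ys i \<in> bad_set I x b)"
proof (cases "feasible_idx I x b N ys = {}")
  case True
  then have "z = None"
    using sel ys z by (auto simp: bon_selection_def)
  moreover have "\<not> (\<exists>i\<in>{1..N}. ys i \<in> bad_set I x b)"
    using True by (auto simp: feasible_idx_def bad_set_def)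
  ultimately show ?thesis by auto
next
  case False
  then have "set_pmf (sel ys) \<subseteq>
      Some ` {i. is_arg_max (\<lambda>i. r_hat I x (ys i)) (\<lambda>i. i \<in> feasible_idx I x b N ys) i}"
    using sel ys by (auto simp: bon_selection_def)
  then obtain i where i: "z = Some i"
    "is_arg_max (\<lambda>i. r_hat I x (ys i)) (\<lambda>i. i \<in> feasible_idx I x b N ys) i"
    using z by auto
  then have i_feas: "i \<in> {1..N}" "ys i \<in> feasible_set I x b"
    and i_max: "\<And>j. j \<in> feasible_idx I x b N ys \<Longrightarrow> r_hat I x (ys j) \<le> r_hat I x (ys i)"
    by (auto simp: is_arg_max_linorder feasible_idx_def)
  have "ys i \<in> bad_set I x b" if j: "j \<in> {1..N}" "ys j \<in> bad_set I x b" for j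
  proof (rule ccontr)
    assume "ys i \<notin> bad_set I x b"
    then have "r_hat I x (ys i) < r_hat I x (ys j)"
      using dom i_feas j by blast
    moreover have "r_hat I x (ys j) \<le> r_hat I x (ys i)"
      using j by (intro i_max) (auto simp: feasible_idx_def bad_set_def)
    ultimately show False by simp
  qed
  then show ?thesis using i i_feas by auto
qed

text \<open>The complementary event, that every coordinate avoids \<open>B\<close>, is a product
  event, so independence turns its probability into a power.\<close>

lemma prob_Pi_pmf_ex:
  assumes "finite A"
  shows "measure_pmf.prob (Pi_pmf A d (\<lambda>_. p)) {f. \<exists>i\<in>A. f i \<in> B} =
    1 - (1 - measure_pmf.prob p B) ^ card A"
proof -
  have "{f. \<exists>i\<in>A. f i \<in> B} = UNIV - Pi A (\<lambda>_. - B)"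
    by auto
  moreover have "measure_pmf.prob p (- B) = 1 - measure_pmf.prob p B"
    using measure_pmf.prob_compl[of B p] by (simp add: Compl_eq_Diff_UNIV)
  ultimately show ?thesis
    using measure_pmf.prob_compl[of "Pi A (\<lambda>_. - B)" "Pi_pmf A d (\<lambda>_. p)"] assms
    by (simp add: measure_Pi_pmf_Pi)
qed

text \<open>Removes \<open>sel\<close> from the problem: whether the output is bad is a function of
  the candidates alone, even where the selected index is random.\<close>

lemma prob_bon_output_bad:
  assumes wf: "wf_instance I" and sel: "bon_selection I x b N sel"
    and dom: "\<And>y z. y \<in> feasible_set I x b - bad_set I x b \<Longrightarrow> z \<in> bad_set I x b \<Longrightarrow>
                r_hat I x y < r_hat I x z"
  shows "measure_pmf.prob (bon_output I x N sel) (Some ` bad_set I x b) =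
    1 - (1 - measure_pmf.prob (pi_ref I x) (bad_set I x b)) ^ N"
proof -
  let ?B = "bad_set I x b" and ?M = "Pi_pmf {1..N} undefined (\<lambda>_. pi_ref I x)"
  \<comment> \<open>Keeping only the truth value of being bad collapses the law of the output, given
    the candidates, to a point mass.\<close>
  have eq: "map_pmf (\<lambda>z. z \<in> Some ` ?B) (map_pmf (map_option ys) (sel ys)) =
      return_pmf (\<exists>i\<in>{1..N}. ys i \<in> ?B)" if "ys \<in> set_pmf ?M" for ys
  proof -
    \<comment> \<open>\<open>bon_selection\<close> constrains \<open>sel\<close> only on candidates
      from \<open>outputs I\<close>; well-formedness places every sampled candidate there.\<close>
    have "ys i \<in> outputs I" if "i \<in> {1..N}" for i
      using that \<open>ys \<in> set_pmf ?M\<close> wf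
      by (auto simp: set_Pi_pmf PiE_dflt_def wf_instance_def)
    then show ?thesis
      unfolding map_pmf_comp
      using bon_selection_bad_iff[OF sel _ dom] by (intro map_pmf_eq_return_pmf) blast
  qed
  have "map_pmf (\<lambda>z. z \<in> Some ` ?B) (bon_output I x N sel) =
      bind_pmf ?M (\<lambda>ys. return_pmf (\<exists>i\<in>{1..N}. ys i \<in> ?B))"
    unfolding bon_output_def map_bind_pmf by (intro bind_pmf_cong refl eq)
  also have "\<dots> = map_pmf (\<lambda>ys. \<exists>i\<in>{1..N}. ys i \<in> ?B) ?M"
    by (simp add: map_pmf_def)
  finally have "measure_pmf.prob (map_pmf (\<lambda>z. z \<in> Some ` ?B) (bon_output I x N sel)) {True} =
      measure_pmf.prob (map_pmf (\<lambda>ys. \<exists>i\<in>{1..N}. ys i \<in> ?B) ?M) {True}"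
    by simp
  then have "measure_pmf.prob (bon_output I x N sel) (Some ` ?B) =
      measure_pmf.prob ?M {ys. \<exists>i\<in>{1..N}. ys i \<in> ?B}"
    by (simp add: measure_map_pmf vimage_def)
  then show ?thesis by (simp only: prob_Pi_pmf_ex finite_atLeastAtMost card_atLeastAtMost) simp
qed

text \<open>This is \<open>1 - \<epsilon> \<le> exp (- \<epsilon>)\<close> raised to the power
  \<open>N\<close>; the assumption keeps the base nonnegative, so that powers are monotone.\<close>

lemma one_minus_power_le_exp:
  fixes \<epsilon> :: real
  assumes "\<epsilon> \<le> 1"
  shows "(1 - \<epsilon>) ^ N \<le> exp (- real N * \<epsilon>)"
proof -
  have "(1 - \<epsilon>) ^ N \<le> exp (- \<epsilon>) ^ N"
    using assms exp_ge_add_one_self[of "- \<epsilon>"] by (intro power_mono) auto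
  then show ?thesis by (simp flip: exp_of_nat_mult)
qed

theorem corollary4p3:
  fixes x :: 'x and b \<epsilon> \<xi> :: real
  assumes "0 < b" and "b \<le> 1" and "0 < \<epsilon>" and "\<epsilon> < 1" and "\<xi> > 0"
  shows "\<exists>I :: ('x, nat) bon_instance.
    wf_instance I \<and> card (outputs I) = 2 \<and>
    measure_pmf.prob (pi_ref I x) (bad_set I x b) = \<epsilon> \<and>
    rmse (pi_ref I x) (g_hat I x) (g_star I x) = b * sqrt \<epsilon> \<and>
    rmse (pi_ref I x) (r_hat I x) (r_star I x) = \<xi> * sqrt \<epsilon> \<and>
    (\<forall>N\<ge>1. \<forall>sel. bon_selection I x b N sel \<longrightarrow>
       measure_pmf.prob (bon_output I x N sel) (Some ` bad_set I x b) = 1 - (1 - \<epsilon>) ^ N \<and>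
       1 - (1 - \<epsilon>) ^ N \<ge> 1 - exp (- real N * \<epsilon>)) \<and>
    (\<forall>\<delta>. 0 < \<delta> \<and> \<delta> < 1 \<longrightarrow>
       (\<forall>N. real N \<ge> inverse \<epsilon> * ln (1 / \<delta>) \<longrightarrow>
         (\<forall>sel. bon_selection I x b N sel \<longrightarrow>
           measure_pmf.prob (bon_output I x N sel) (Some ` bad_set I x b) \<ge> 1 - \<delta>)))"
proof -
  define p :: "nat pmf" where "p = map_pmf of_bool (bernoulli_pmf \<epsilon>)"
  \<comment> \<open>Output \<open>1\<close> is the unsafe atom. With \<open>r_star\<close> zero, the
    reward error there is exactly \<open>\<xi>\<close>, and the safety error is \<open>b\<close>,
    the smallest proxy value that is still feasible.\<close>
  define I :: "('x, nat) bon_instance" where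
    "I = \<lparr>outputs = {0, 1}, pi_ref = \<lambda>_. p, r_star = \<lambda>_ _. 0,
          g_star = \<lambda>_ y. if y = 1 then 0 else 1,
          r_hat = \<lambda>_ y. if y = 1 then \<xi> else 0,
          g_hat = \<lambda>_ y. if y = 1 then b else 1\<rparr>"
  have wf: "wf_instance I"
    using assms by (auto simp: wf_instance_def I_def p_def)
  have feasible: "feasible_set I x b = {0, 1}"
    using assms by (auto simp: feasible_set_def I_def)
  have bad: "bad_set I x b = {1}"
    unfolding bad_set_def feasible by (auto simp: I_def)
  have prob_bad: "measure_pmf.prob (pi_ref I x) (bad_set I x b) = \<epsilon>"
  proof -
    have "of_bool -` {1 :: nat} = {True}" by (auto simp: of_bool_def split: if_splits)
    then show ?thesis
      unfolding bad using assms by (simp add: I_def p_def pmf_map measure_pmf_single)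
  qed
  \<comment> \<open>Only output \<open>1\<close> contributes, so the mean squared errors are
    \<open>\<epsilon>\<close> times the squares of \<open>b\<close> and
    \<open>\<xi>\<close>.\<close>
  have rmse: "rmse (pi_ref I x) (g_hat I x) (g_star I x) = b * sqrt \<epsilon>"
    "rmse (pi_ref I x) (r_hat I x) (r_star I x) = \<xi> * sqrt \<epsilon>"
    using assms by (simp_all add: rmse_def I_def p_def real_sqrt_mult)
  \<comment> \<open>Output \<open>0\<close> is the only feasible output that is not bad, so the
    domination condition reduces to \<open>0 < \<xi>\<close>.\<close>
  have bon: "measure_pmf.prob (bon_output I x N sel) (Some ` bad_set I x b) = 1 - (1 - \<epsilon>) ^ N"
    if "bon_selection I x b N sel" for N sel
    using prob_bon_output_bad[OF wf that] assms unfolding prob_bad unfolding feasible bad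
    by (simp add: I_def)
  have tail: "(1 - \<epsilon>) ^ N \<le> \<delta>" if "0 < \<delta>" "real N \<ge> inverse \<epsilon> * ln (1 / \<delta>)" for N \<delta>
  proof -
    \<comment> \<open>The bound on \<open>N\<close> multiplied by \<open>\<epsilon>\<close>, using
      \<open>ln (1 / \<delta>) = - ln \<delta>\<close>.\<close>
    have "- real N * \<epsilon> \<le> ln \<delta>"
      using that assms by (simp add: field_simps ln_div)
    then have "exp (- real N * \<epsilon>) \<le> \<delta>"
      using that by (metis exp_le_cancel_iff exp_ln)
    then show ?thesis
      using one_minus_power_le_exp[of \<epsilon> N] assms by simp
  qed
  have "card (outputs I) = 2" by (simp add: I_def)
  then show ?thesis
    using wf prob_bad rmse bon tail one_minus_power_le_exp[of \<epsilon>] assms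
    by (intro exI[of _ I]) auto
qed

end
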